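(* Let $\Gamma$ be a finite graph with at least one vertex, all of whose edges are labelled by $2$, and let $W_\Gamma$ be the associated right-angled Coxeter group. Then $W_\Gamma$ has Property (NL) if and only if $\Gamma$ is complete.
   Context: A Coxeter graph is a finite graph $\Gamma$ with vertices $s_1,\dots,s_n$ ($n\ge 1$) in which two distinct vertices $s_i,s_j$ may be joined by at most one edge (no loops), labelled by an integer $m_{ij}=m_{ji}\ge 2$. The associated Coxeter group $W_\Gamma$ has the presentation with generators $s_1,\dots,s_n$ and relations $s_i^2=1$ for all $i$, and $(s_is_j)^{m_{ij}}=1$ whenever $s_i$ and $s_j$ are joined by an edge labelled $m_{ij}$. (A missing edge means no relation between the two generators.) The group is right-angled if all edge labels equal $2$. The graph $\Gamma$ is complete if every pair of distinct vertices is joined by an edge. A geodesic metric space $X$ is hyperbolic if there is $\delta\ge 0$ such that for all $x,y,z\in X$ and all geodesics $[x,y],[y,z],[x,z]$, the side $[x,z]$ is contained in the $\delta$-neighborhood of $[x,y]\cup[y,z]$. For an isometric action of a group $G$ on a (nonempty) hyperbolic space $X$, an element $g\in G$ is loxodromic if the map $\mathbb{Z}\to X$, $n\mapsto g^n x_0$, is a quasi-isometric embedding for some (equivalently, every) $x_0\in X$. Here a map $q:Y\to X$ of metric spaces is a quasi-isometric embedding if there is $C\ge 1$ with $\frac1C d_Y(a,b)-C\le d_X(q(a),q(b))\le C d_Y(a,b)+C$ for all $a,b\in Y$. A group $G$ has Property (NL) if for every isometric action of $G$ on every hyperbolic space, no element of $G$ is loxodromic. *)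

theory Defs
  imports "HOL-Analysis.Abstract_Metric_Spaces" "HOL-Algebra.Group_Action"
begin

section \<open>Groups given by generators and relations\<close>

text \<open>
  A word over \<open>S\<close> is a list of letters \<open>(s, b)\<close> with \<open>s \<in> S\<close>; the letter \<open>(s, True)\<close> stands for
  \<open>s\<close> and \<open>(s, False)\<close> for its formal inverse.
\<close>

type_synonym 'a word = "('a \<times> bool) list"

definition words :: "'a set \<Rightarrow> 'a word set" where
  "words S = lists (S \<times> UNIV)"

text \<open>
  The smallest congruence on words that contains \<open>s s\<^sup>-\<^sup>1 \<sim> 1\<close>, \<open>s\<^sup>-\<^sup>1 s \<sim> 1\<close> and \<open>r \<sim> 1\<close> for every
  relator \<open>r \<in> R\<close>.
\<close>

inductive_set word_cong :: "'a set \<Rightarrow> 'a word set \<Rightarrow> 'a word rel"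
  for S :: "'a set" and R :: "'a word set" where
  refl: "w \<in> words S \<Longrightarrow> (w, w) \<in> word_cong S R"
| sym: "(v, w) \<in> word_cong S R \<Longrightarrow> (w, v) \<in> word_cong S R"
| trans: "(u, v) \<in> word_cong S R \<Longrightarrow> (v, w) \<in> word_cong S R \<Longrightarrow> (u, w) \<in> word_cong S R"
| cancel: "u \<in> words S \<Longrightarrow> v \<in> words S \<Longrightarrow> s \<in> S \<Longrightarrow>
    (u @ [(s, b), (s, \<not> b)] @ v, u @ v) \<in> word_cong S R"
| relator: "u \<in> words S \<Longrightarrow> v \<in> words S \<Longrightarrow> r \<in> words S \<Longrightarrow> r \<in> R \<Longrightarrow>
    (u @ r @ v, u @ v) \<in> word_cong S R"

definition presented_group :: "'a set \<Rightarrow> 'a word set \<Rightarrow> 'a word set monoid" where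
  "presented_group S R =
    \<lparr>carrier = words S // word_cong S R,
     monoid.mult = (\<lambda>A B. \<Union>u\<in>A. \<Union>v\<in>B. word_cong S R `` {u @ v}),
     one = word_cong S R `` {[]}\<rparr>"

lemma words_simps [simp]:
  "[] \<in> words S"
  "x # w \<in> words S \<longleftrightarrow> fst x \<in> S \<and> w \<in> words S"
  "u @ v \<in> words S \<longleftrightarrow> u \<in> words S \<and> v \<in> words S"
  by (cases x; auto simp: words_def)+

lemma inverse_word_in_words: "w \<in> words S \<Longrightarrow> rev (map (apsnd Not) w) \<in> words S"
  by (induction w) auto

lemma word_cong_words: "(u, v) \<in> word_cong S R \<Longrightarrow> u \<in> words S \<and> v \<in> words S"
  by (induction rule: word_cong.induct) auto

lemma equiv_word_cong: "equiv (words S) (word_cong S R)"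
proof (rule equivI)
  show "word_cong S R \<subseteq> words S \<times> words S"
    using word_cong_words by fastforce
  show "refl_on (words S) (word_cong S R)"
    by (auto simp: refl_on_def intro: word_cong.refl)
  show "Relation.sym (word_cong S R)"
    by (auto simp: sym_def intro: word_cong.sym)
  show "Relation.trans (word_cong S R)"
    by (auto simp: trans_def intro: word_cong.trans)
qed

lemma word_cong_context:
  assumes "(u, v) \<in> word_cong S R" "a \<in> words S" "b \<in> words S"
  shows "(a @ u @ b, a @ v @ b) \<in> word_cong S R"
  using assms(1)
proof (induction rule: word_cong.induct)
  case (refl w)
  then show ?case using assms by (intro word_cong.refl) auto
next
  case (sym v w)
  then show ?case by (blast intro: word_cong.sym)
next
  case (trans u v w)
  then show ?case by (blast intro: word_cong.trans)
next
  case (cancel u v s c)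
  then show ?case
    using assms word_cong.cancel[of "a @ u" S "v @ b" s c R] by simp
next
  case (relator u v r)
  then show ?case
    using assms word_cong.relator[of "a @ u" S "v @ b" r R] by simp
qed

lemma word_cong_append:
  assumes "(u, u') \<in> word_cong S R" "(v, v') \<in> word_cong S R"
  shows "(u @ v, u' @ v') \<in> word_cong S R"
  using word_cong_context[OF assms(1), of "[]" v] word_cong_context[OF assms(2), of u' "[]"]
    assms[THEN word_cong_words] by (auto intro: word_cong.trans)

lemma word_cong_inverse:
  assumes "w \<in> words S"
  shows "(rev (map (apsnd Not) w) @ w, []) \<in> word_cong S R"
  using assms
proof (induction w)
  case Nil
  then show ?case by (simp add: word_cong.refl)
next
  case (Cons x w)
  have inv: "rev (map (apsnd Not) w) \<in> words S"
    using Cons.prems by (simp add: inverse_word_in_words)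
  obtain s b where x: "x = (s, b)" by force
  have "(rev (map (apsnd Not) w) @ [(s, \<not> b), (s, \<not> \<not> b)] @ w,
      rev (map (apsnd Not) w) @ w) \<in> word_cong S R"
    using Cons.prems inv x by (intro word_cong.cancel) auto
  then show ?case
    using Cons x by (auto intro: word_cong.trans)
qed

lemma presented_group_mult:
  assumes "u \<in> words S" "v \<in> words S"
  shows "monoid.mult (presented_group S R) (word_cong S R `` {u}) (word_cong S R `` {v}) =
    word_cong S R `` {u @ v}"
proof -
  have eq: "word_cong S R `` {u' @ v'} = word_cong S R `` {u @ v}"
    if "u' \<in> word_cong S R `` {u}" "v' \<in> word_cong S R `` {v}" for u' v'
    using that by (intro equiv_class_eq[OF equiv_word_cong] word_cong_append) (auto intro: word_cong.sym)
  have ne: "u \<in> word_cong S R `` {u}" "v \<in> word_cong S R `` {v}"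
    using assms by (auto intro: word_cong.refl)
  have "(\<Union>u'\<in>word_cong S R `` {u}. \<Union>v'\<in>word_cong S R `` {v}. word_cong S R `` {u' @ v'}) =
    (\<Union>u'\<in>word_cong S R `` {u}. \<Union>v'\<in>word_cong S R `` {v}. word_cong S R `` {u @ v})"
    by (intro SUP_cong HOL.refl eq)
  also have "\<dots> = word_cong S R `` {u @ v}"
    using ne by (metis UN_constant empty_iff)
  finally show ?thesis
    by (simp add: presented_group_def)
qed

lemma group_presented_group: "group (presented_group S R)"
proof (rule groupI)
  let ?G = "presented_group S R"
  let ?c = "\<lambda>w. word_cong S R `` {w}"
  have car: "carrier ?G = ?c ` words S" and one: "\<one>\<^bsub>?G\<^esub> = ?c []"
    by (auto simp: presented_group_def quotient_def)
  show "\<one>\<^bsub>?G\<^esub> \<in> carrier ?G"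
    by (simp add: car one)
  fix x assume "x \<in> carrier ?G"
  then obtain u where u: "u \<in> words S" "x = ?c u" by (auto simp: car)
  show "\<one>\<^bsub>?G\<^esub> \<otimes>\<^bsub>?G\<^esub> x = x"
    by (simp add: u one presented_group_mult)
  have inv: "rev (map (apsnd Not) u) \<in> words S"
    using u(1) by (rule inverse_word_in_words)
  have "?c (rev (map (apsnd Not) u)) \<otimes>\<^bsub>?G\<^esub> x = \<one>\<^bsub>?G\<^esub>"
    using equiv_class_eq[OF equiv_word_cong word_cong_inverse[OF u(1), of R]] inv
    by (simp add: u one presented_group_mult)
  then show "\<exists>y\<in>carrier ?G. y \<otimes>\<^bsub>?G\<^esub> x = \<one>\<^bsub>?G\<^esub>"
    using inv by (auto simp: car)
  fix y assume "y \<in> carrier ?G"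
  then obtain v where v: "v \<in> words S" "y = ?c v" by (auto simp: car)
  show "x \<otimes>\<^bsub>?G\<^esub> y \<in> carrier ?G"
    using u v by (simp add: car presented_group_mult)
  fix z assume "z \<in> carrier ?G"
  then obtain w where w: "w \<in> words S" "z = ?c w" by (auto simp: car)
  show "x \<otimes>\<^bsub>?G\<^esub> y \<otimes>\<^bsub>?G\<^esub> z = x \<otimes>\<^bsub>?G\<^esub> (y \<otimes>\<^bsub>?G\<^esub> z)"
    using u v w by (simp add: presented_group_mult)
qed

section \<open>Coxeter graphs and Coxeter groups\<close>

text \<open>An edge is an unordered pair \<open>{s, t}\<close>; \<open>m\<close> gives the labels and matters only on \<open>E\<close>.\<close>

definition coxeter_graph :: "'v set \<Rightarrow> 'v set set \<Rightarrow> ('v set \<Rightarrow> nat) \<Rightarrow> bool" where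
  "coxeter_graph V E m \<longleftrightarrow>
    finite V \<and> V \<noteq> {} \<and> E \<subseteq> {{s, t} | s t. s \<in> V \<and> t \<in> V \<and> s \<noteq> t} \<and> (\<forall>e\<in>E. 2 \<le> m e)"

definition right_angled :: "'v set set \<Rightarrow> ('v set \<Rightarrow> nat) \<Rightarrow> bool" where
  "right_angled E m \<longleftrightarrow> (\<forall>e\<in>E. m e = 2)"

definition complete_graph :: "'v set \<Rightarrow> 'v set set \<Rightarrow> bool" where
  "complete_graph V E \<longleftrightarrow> (\<forall>s\<in>V. \<forall>t\<in>V. s \<noteq> t \<longrightarrow> {s, t} \<in> E)"

definition coxeter_relators :: "'v set \<Rightarrow> 'v set set \<Rightarrow> ('v set \<Rightarrow> nat) \<Rightarrow> 'v word set" where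
  "coxeter_relators V E m =
    {[(s, True), (s, True)] | s. s \<in> V} \<union>
    {concat (replicate (m {s, t}) [(s, True), (t, True)]) | s t. {s, t} \<in> E}"

definition coxeter_group :: "'v set \<Rightarrow> 'v set set \<Rightarrow> ('v set \<Rightarrow> nat) \<Rightarrow> 'v word set monoid" where
  "coxeter_group V E m = presented_group V (coxeter_relators V E m)"

section \<open>Hyperbolic spaces and Property (NL)\<close>

text \<open>A metric space is a carrier set \<open>X\<close> with a distance \<open>d\<close>, as in \<^locale>\<open>Metric_space\<close>.\<close>

definition geodesic_segment :: "'x set \<Rightarrow> ('x \<Rightarrow> 'x \<Rightarrow> real) \<Rightarrow> 'x \<Rightarrow> 'x \<Rightarrow> 'x set \<Rightarrow> bool" where
  "geodesic_segment X d x y S \<longleftrightarrow>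
    (\<exists>\<gamma>. \<gamma> \<in> {0..d x y} \<rightarrow> X \<and> \<gamma> 0 = x \<and> \<gamma> (d x y) = y \<and>
      (\<forall>s\<in>{0..d x y}. \<forall>t\<in>{0..d x y}. d (\<gamma> s) (\<gamma> t) = \<bar>s - t\<bar>) \<and> S = \<gamma> ` {0..d x y})"

definition geodesic_metric_space :: "'x set \<Rightarrow> ('x \<Rightarrow> 'x \<Rightarrow> real) \<Rightarrow> bool" where
  "geodesic_metric_space X d \<longleftrightarrow>
    Metric_space X d \<and> (\<forall>x\<in>X. \<forall>y\<in>X. \<exists>S. geodesic_segment X d x y S)"

definition nbhd :: "'x set \<Rightarrow> ('x \<Rightarrow> 'x \<Rightarrow> real) \<Rightarrow> real \<Rightarrow> 'x set \<Rightarrow> 'x set" where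
  "nbhd X d \<delta> A = {p \<in> X. \<exists>q\<in>A. d p q \<le> \<delta>}"

definition hyperbolic_space :: "'x set \<Rightarrow> ('x \<Rightarrow> 'x \<Rightarrow> real) \<Rightarrow> bool" where
  "hyperbolic_space X d \<longleftrightarrow>
    X \<noteq> {} \<and> geodesic_metric_space X d \<and>
    (\<exists>\<delta>\<ge>0. \<forall>x\<in>X. \<forall>y\<in>X. \<forall>z\<in>X. \<forall>A B C.
      geodesic_segment X d x y A \<longrightarrow> geodesic_segment X d y z B \<longrightarrow> geodesic_segment X d x z C \<longrightarrow>
      C \<subseteq> nbhd X d \<delta> (A \<union> B))"

definition quasi_isometric_embedding ::
  "'y set \<Rightarrow> ('y \<Rightarrow> 'y \<Rightarrow> real) \<Rightarrow> 'x set \<Rightarrow> ('x \<Rightarrow> 'x \<Rightarrow> real) \<Rightarrow> ('y \<Rightarrow> 'x) \<Rightarrow> bool" where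
  "quasi_isometric_embedding Y dY X dX q \<longleftrightarrow>
    q \<in> Y \<rightarrow> X \<and>
    (\<exists>C\<ge>1. \<forall>a\<in>Y. \<forall>b\<in>Y.
      1 / C * dY a b - C \<le> dX (q a) (q b) \<and> dX (q a) (q b) \<le> C * dY a b + C)"

definition isometric_action ::
  "('g, 'm) monoid_scheme \<Rightarrow> 'x set \<Rightarrow> ('x \<Rightarrow> 'x \<Rightarrow> real) \<Rightarrow> ('g \<Rightarrow> 'x \<Rightarrow> 'x) \<Rightarrow> bool" where
  "isometric_action G X d \<phi> \<longleftrightarrow>
    group_action G X \<phi> \<and> (\<forall>g\<in>carrier G. \<forall>x\<in>X. \<forall>y\<in>X. d (\<phi> g x) (\<phi> g y) = d x y)"

definition loxodromic ::
  "('g, 'm) monoid_scheme \<Rightarrow> 'x set \<Rightarrow> ('x \<Rightarrow> 'x \<Rightarrow> real) \<Rightarrow> ('g \<Rightarrow> 'x \<Rightarrow> 'x) \<Rightarrow> 'g \<Rightarrow> bool" where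
  "loxodromic G X d \<phi> g \<longleftrightarrow>
    (\<exists>x\<^sub>0\<in>X. quasi_isometric_embedding (UNIV :: int set) (\<lambda>m n. real_of_int \<bar>m - n\<bar>) X d
      (\<lambda>n. \<phi> (g [^]\<^bsub>G\<^esub> n) x\<^sub>0))"

text \<open>
  HOL cannot quantify over types inside a formula, so Property (NL) is indexed by the type \<open>'x\<close> whose
  subsets carry the spaces; the property proper is its validity for all types \<open>'x\<close>.
  On a type with fewer elements than the reals every geodesic space is a point and the property holds
  for every group. Hence a characterisation by a single equivalence has to be stated for types that
  are not too small, for instance the types \<open>'x + real\<close> with \<open>'x\<close> arbitrary: they contain a copy of
  every space carried by a subset of any type.
\<close>

definition property_NL :: "'x itself \<Rightarrow> ('g, 'm) monoid_scheme \<Rightarrow> bool" where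
  "property_NL _ G \<longleftrightarrow>
    (\<forall>(X :: 'x set) d \<phi>. hyperbolic_space X d \<longrightarrow> isometric_action G X d \<phi> \<longrightarrow>
      \<not> (\<exists>g\<in>carrier G. loxodromic G X d \<phi> g))"

end

theory Submission
  imports Defs
begin

text \<open>
  If \<open>\<Gamma>\<close> is complete, then all generators of \<open>W\<^sub>\<Gamma>\<close> are commuting involutions, so every element squares
  to the identity (\<open>complete_right_angled_square\<close>). The powers of an element of finite order have
  only finitely many values, so the orbit map of such an element cannot be a quasi-isometric embedding
  of \<open>\<int>\<close> (\<open>finite_order_not_loxodromic\<close>), whatever the space is.

  If \<open>\<Gamma>\<close> is not complete, choose distinct vertices \<open>s\<close>, \<open>t\<close> that are not joined. Killing all other
  generators maps \<open>W\<^sub>\<Gamma>\<close> onto the infinite dihedral group generated by \<open>s\<close> and \<open>t\<close>, and that group acts on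
  the real line: \<open>s\<close> and \<open>t\<close> become the reflections \<open>x \<mapsto> -x\<close> and \<open>x \<mapsto> 1 - x\<close>. The relators of \<open>W\<^sub>\<Gamma>\<close>
  are respected because every edge has an end that acts trivially, so the universal property
  \<open>presented_group_hom\<close> gives the action. The line is hyperbolic with \<open>\<delta> = 0\<close>, and \<open>s t\<close>, the product
  of the two reflections, is a unit translation and hence loxodromic. The line is realised as the
  right summand of \<open>'x + real\<close>, so it is available whatever \<open>'x\<close> is.
\<close>

section \<open>Homomorphisms out of presented groups\<close>

definition word_value :: "('g, 'm) monoid_scheme \<Rightarrow> ('a \<Rightarrow> 'g) \<Rightarrow> 'a word \<Rightarrow> 'g" where
  "word_value H f w =
    foldr (\<lambda>(s, b) y. (if b then f s else inv\<^bsub>H\<^esub> (f s)) \<otimes>\<^bsub>H\<^esub> y) w \<one>\<^bsub>H\<^esub>"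

lemma word_value_simps [simp]:
  "word_value H f [] = \<one>\<^bsub>H\<^esub>"
  "word_value H f ((s, b) # w) = (if b then f s else inv\<^bsub>H\<^esub> (f s)) \<otimes>\<^bsub>H\<^esub> word_value H f w"
  by (simp_all add: word_value_def)

text \<open>Stated for subgroups, so that it also shows that a presented group acts by isometries as soon
  as its generators do.\<close>

lemma word_value_in_subgroup:
  assumes "group H" "subgroup K H" "f \<in> S \<rightarrow> K" "w \<in> words S"
  shows "word_value H f w \<in> K"
  using assms(4)
proof (induction w)
  case Nil
  then show ?case using subgroup.one_closed[OF assms(2)] by simp
next
  case (Cons x w)
  obtain s b where x: "x = (s, b)" by force
  have "f s \<in> K" using Cons.prems x assms(3) by auto
  then show ?case
    using Cons x subgroup.m_closed[OF assms(2)] subgroup.m_inv_closed[OF assms(2)] by auto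
qed

lemma word_value_closed:
  assumes "group H" "f \<in> S \<rightarrow> carrier H" "w \<in> words S"
  shows "word_value H f w \<in> carrier H"
  using word_value_in_subgroup[OF assms(1) group.subgroup_self[OF assms(1)] assms(2,3)] .

lemma word_value_append:
  assumes "group H" "f \<in> S \<rightarrow> carrier H" "u \<in> words S" "v \<in> words S"
  shows "word_value H f (u @ v) = word_value H f u \<otimes>\<^bsub>H\<^esub> word_value H f v"
  using assms(3)
proof (induction u)
  case Nil
  then show ?case
    using assms by (simp add: word_value_closed group.is_monoid monoid.l_one)
next
  case (Cons x u)
  obtain s b where x: "x = (s, b)" by force
  have "f s \<in> carrier H" using Cons.prems x assms(2) by auto
  moreover have "word_value H f u \<in> carrier H" "word_value H f v \<in> carrier H"
    using Cons.prems assms word_value_closed by fastforce+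
  ultimately show ?case
    using Cons x assms(1) by (simp add: group.is_monoid monoid.m_assoc)
qed

lemma word_value_cong:
  assumes H: "group H" and f: "f \<in> S \<rightarrow> carrier H"
    and R: "\<And>r. r \<in> R \<Longrightarrow> r \<in> words S \<Longrightarrow> word_value H f r = \<one>\<^bsub>H\<^esub>"
    and "(u, v) \<in> word_cong S R"
  shows "word_value H f u = word_value H f v"
  using assms(4)
proof (induction rule: word_cong.induct)
  case (cancel u v s b)
  interpret H: group H by fact
  have "f s \<in> carrier H" using cancel f by auto
  moreover have "word_value H f v \<in> carrier H"
    using cancel f H word_value_closed by blast
  ultimately have "word_value H f ([(s, b), (s, \<not> b)] @ v) = word_value H f v"
    by (simp add: H.m_assoc[symmetric])
  moreover have "[(s, b), (s, \<not> b)] @ v \<in> words S" using cancel by simp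
  ultimately show ?case
    using word_value_append[OF H f] cancel by metis
next
  case (relator u v r)
  interpret H: group H by fact
  show ?case
    using relator R by (simp add: word_value_append[OF H f] word_value_closed[OF H f])
qed auto

lemma presented_group_carrier:
  "carrier (presented_group S R) = (\<lambda>w. word_cong S R `` {w}) ` words S"
  by (auto simp: presented_group_def quotient_def)

lemma presented_group_one: "\<one>\<^bsub>presented_group S R\<^esub> = word_cong S R `` {[]}"
  by (simp add: presented_group_def)

text \<open>The universal property of a presentation (von Dyck's theorem).\<close>

lemma presented_group_hom:
  assumes H: "group H" and f: "f \<in> S \<rightarrow> carrier H"
    and R: "\<And>r. r \<in> R \<Longrightarrow> r \<in> words S \<Longrightarrow> word_value H f r = \<one>\<^bsub>H\<^esub>"
  obtains h where "h \<in> hom (presented_group S R) H"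
    and "\<And>w. w \<in> words S \<Longrightarrow> h (word_cong S R `` {w}) = word_value H f w"
proof -
  let ?c = "\<lambda>w. word_cong S R `` {w}"
  define h where "h A = word_value H f (SOME w. w \<in> A)" for A
  have h: "h (?c w) = word_value H f w" if w: "w \<in> words S" for w
  proof -
    have "w \<in> ?c w" using w by (auto intro: word_cong.refl)
    then have "(SOME v. v \<in> ?c w) \<in> ?c w" by (rule someI)
    then have "(w, SOME v. v \<in> ?c w) \<in> word_cong S R" by blast
    then have "word_value H f w = word_value H f (SOME v. v \<in> ?c w)"
      using word_value_cong[OF H f R] by blast
    then show ?thesis by (simp add: h_def)
  qed
  have "h \<in> hom (presented_group S R) H"
    by (rule homI) (auto simp: presented_group_carrier presented_group_mult h
        word_value_closed[OF H f] word_value_append[OF H f])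
  then show ?thesis using h that by blast
qed

section \<open>Complete graphs\<close>

lemma finite_order_not_loxodromic:
  assumes act: "isometric_action G X d \<phi>" and met: "Metric_space X d"
    and g: "g \<in> carrier G" and n: "n > 0" "g [^]\<^bsub>G\<^esub> (n::nat) = \<one>\<^bsub>G\<^esub>"
  shows "\<not> loxodromic G X d \<phi> g"
proof
  assume "loxodromic G X d \<phi> g"
  then obtain x C where x: "x \<in> X" and C: "C \<ge> 1"
    and emb: "\<And>a b :: int. 1 / C * real_of_int \<bar>a - b\<bar> - C
        \<le> d (\<phi> (g [^]\<^bsub>G\<^esub> a) x) (\<phi> (g [^]\<^bsub>G\<^esub> b) x)"
    unfolding loxodromic_def quasi_isometric_embedding_def by auto
  interpret group_action G X \<phi> using act by (simp add: isometric_action_def)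
  interpret G: group G by (rule group_hom.axioms(1)[OF group_hom])
  interpret Metric_space X d by fact
  obtain k :: nat where k: "C * C < real k" using reals_Archimedean2 by blast
  \<comment> \<open>The exponents \<open>n k\<close> and \<open>0\<close> give the same orbit point but are far apart in \<open>\<int>\<close>.\<close>
  have pow: "g [^]\<^bsub>G\<^esub> int (n * k) = g [^]\<^bsub>G\<^esub> (0::int)"
    using n g by (simp only: int_pow_int int_pow_0 G.nat_pow_pow[symmetric] G.nat_pow_one)
  have "\<phi> (g [^]\<^bsub>G\<^esub> (0::int)) x \<in> X"
    using x g element_image by blast
  then have "1 / C * real (n * k) - C \<le> 0"
    using emb[of "int (n * k)" 0] by (simp only: pow) simp
  then have "real (n * k) \<le> C * C"
    using C by (simp add: field_simps)
  moreover have "k \<le> n * k" using n(1) by simp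
  then have "real k \<le> real (n * k)" by (simp only: of_nat_le_iff)
  ultimately show False using k by linarith
qed

lemma complete_right_angled_square:
  assumes "right_angled E m" "complete_graph V E" "g \<in> carrier (coxeter_group V E m)"
  shows "g \<otimes>\<^bsub>coxeter_group V E m\<^esub> g = \<one>\<^bsub>coxeter_group V E m\<^esub>"
proof -
  let ?R = "coxeter_relators V E m"
  let ?c = "\<lambda>w. word_cong V ?R `` {w}"
  let ?\<gamma> = "\<lambda>s. ?c [(s, True)]"
  define G where "G = presented_group V ?R"
  interpret G: group G unfolding G_def by (rule group_presented_group)
  have mult: "?c u \<otimes>\<^bsub>G\<^esub> ?c v = ?c (u @ v)" if "u \<in> words V" "v \<in> words V" for u v
    using that unfolding G_def by (rule presented_group_mult)
  have one: "\<one>\<^bsub>G\<^esub> = ?c []" by (simp add: G_def presented_group_one)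
  have car: "?c w \<in> carrier G" if "w \<in> words V" for w
    using that by (simp add: G_def presented_group_carrier)
  have rel: "?c r = \<one>\<^bsub>G\<^esub>" if "r \<in> ?R" "r \<in> words V" for r
    using word_cong.relator[of "[]" V "[]" r ?R] that
    unfolding one by (intro equiv_class_eq[OF equiv_word_cong]) simp
  have sq: "?\<gamma> s \<otimes>\<^bsub>G\<^esub> ?\<gamma> s = \<one>\<^bsub>G\<^esub>" if "s \<in> V" for s
  proof -
    have "[(s, True), (s, True)] \<in> ?R" using that by (auto simp: coxeter_relators_def)
    then show ?thesis using that rel by (simp add: mult)
  qed
  have letter: "?c [(s, b)] = ?\<gamma> s" if s: "s \<in> V" for s b
  proof (cases b)
    case False
    have "?c [(s, False)] \<otimes>\<^bsub>G\<^esub> ?\<gamma> s = \<one>\<^bsub>G\<^esub>"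
      using s word_cong.cancel[of "[]" V "[]" s False ?R] equiv_class_eq[OF equiv_word_cong]
      by (fastforce simp: mult one)
    then show ?thesis
      using sq[OF s] False car s G.right_cancel
      by (metis words_simps fst_conv)
  qed simp
  have comm_gen: "?\<gamma> s \<otimes>\<^bsub>G\<^esub> ?\<gamma> t = ?\<gamma> t \<otimes>\<^bsub>G\<^esub> ?\<gamma> s" if st: "s \<in> V" "t \<in> V" for s t
  proof (cases "s = t")
    case False
    then have e: "{s, t} \<in> E" using assms(2) st by (simp add: complete_graph_def)
    then have "m {s, t} = 2" using assms(1) by (simp add: right_angled_def)
    then have "concat (replicate 2 [(s, True), (t, True)]) \<in> ?R"
      using e unfolding coxeter_relators_def by force
    then have "[(s, True), (t, True), (s, True), (t, True)] \<in> ?R"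
      by (simp add: numeral_2_eq_2)
    then have st1: "(?\<gamma> s \<otimes>\<^bsub>G\<^esub> ?\<gamma> t) \<otimes>\<^bsub>G\<^esub> (?\<gamma> s \<otimes>\<^bsub>G\<^esub> ?\<gamma> t) = \<one>\<^bsub>G\<^esub>"
      using rel st by (simp add: mult)
    have c: "?\<gamma> s \<in> carrier G" "?\<gamma> t \<in> carrier G" using st car by simp_all
    have "inv\<^bsub>G\<^esub> (?\<gamma> s \<otimes>\<^bsub>G\<^esub> ?\<gamma> t) = ?\<gamma> s \<otimes>\<^bsub>G\<^esub> ?\<gamma> t"
      using st1 c by (simp add: G.inv_equality)
    moreover have "inv\<^bsub>G\<^esub> (?\<gamma> s) = ?\<gamma> s" "inv\<^bsub>G\<^esub> (?\<gamma> t) = ?\<gamma> t"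
      using sq st c by (simp_all add: G.inv_equality)
    ultimately show ?thesis using G.inv_mult_group[OF c] by simp
  qed simp
  have comm: "?\<gamma> s \<otimes>\<^bsub>G\<^esub> ?c w = ?c w \<otimes>\<^bsub>G\<^esub> ?\<gamma> s" if "s \<in> V" "w \<in> words V" for s w
    using that(2)
  proof (induction w)
    case Nil
    then show ?case using that(1) by (simp add: mult)
  next
    case (Cons x w)
    obtain t b where x: "x = (t, b)" by force
    have t: "t \<in> V" and w: "w \<in> words V" using Cons.prems x by auto
    have cw: "?c (x # w) = ?\<gamma> t \<otimes>\<^bsub>G\<^esub> ?c w"
      using mult[of "[x]" w] letter[OF t, of b] t w x by simp
    have c: "?\<gamma> s \<in> carrier G" "?\<gamma> t \<in> carrier G" "?c w \<in> carrier G"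
      using t w car that(1) by simp_all
    have "?\<gamma> s \<otimes>\<^bsub>G\<^esub> (?\<gamma> t \<otimes>\<^bsub>G\<^esub> ?c w) = ?\<gamma> t \<otimes>\<^bsub>G\<^esub> (?\<gamma> s \<otimes>\<^bsub>G\<^esub> ?c w)"
      using c comm_gen[OF that(1) t] by (metis G.m_assoc)
    also have "\<dots> = ?\<gamma> t \<otimes>\<^bsub>G\<^esub> ?c w \<otimes>\<^bsub>G\<^esub> ?\<gamma> s"
      using c Cons.IH[OF w] by (metis G.m_assoc)
    finally show ?case unfolding cw .
  qed
  have "?c w \<otimes>\<^bsub>G\<^esub> ?c w = \<one>\<^bsub>G\<^esub>" if "w \<in> words V" for w
    using that
  proof (induction w)
    case Nil
    then show ?case by (simp add: mult one)
  next
    case (Cons x w)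
    obtain t b where x: "x = (t, b)" by force
    have t: "t \<in> V" and w: "w \<in> words V" using Cons.prems x by auto
    have cw: "?c (x # w) = ?\<gamma> t \<otimes>\<^bsub>G\<^esub> ?c w"
      using mult[of "[x]" w] letter[OF t, of b] t w x by simp
    have c: "?\<gamma> t \<in> carrier G" "?c w \<in> carrier G"
      using t w car by simp_all
    have "(?\<gamma> t \<otimes>\<^bsub>G\<^esub> ?c w) \<otimes>\<^bsub>G\<^esub> (?\<gamma> t \<otimes>\<^bsub>G\<^esub> ?c w) = (?\<gamma> t \<otimes>\<^bsub>G\<^esub> ?\<gamma> t) \<otimes>\<^bsub>G\<^esub> (?c w \<otimes>\<^bsub>G\<^esub> ?c w)"
      using c comm[OF t w] by (metis G.m_assoc G.m_closed)
    then show ?case using sq[OF t] Cons.IH[OF w] by (simp add: cw)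
  qed
  then show ?thesis
    using assms(3) by (auto simp: coxeter_group_def G_def[symmetric])
      (auto simp: G_def presented_group_carrier)
qed

section \<open>The real line and its isometries\<close>

abbreviation line :: "('x + real) set" where
  "line \<equiv> range Inr"

definition line_dist :: "'x + real \<Rightarrow> 'x + real \<Rightarrow> real" where
  "line_dist p q = \<bar>projr p - projr q\<bar>"

lemma line_dist_Inr [simp]: "line_dist (Inr a) (Inr b) = \<bar>a - b\<bar>"
  by (simp add: line_dist_def)

lemma Metric_space_line: "Metric_space line line_dist"
  by unfold_locales (auto simp: line_dist_def)

text \<open>Every geodesic from \<open>x\<close> to \<open>y\<close> is the whole interval between them; this makes the line a tree.\<close>

lemma geodesic_segment_line:
  fixes S :: "('x + real) set"
  assumes "geodesic_segment line line_dist (Inr x) (Inr y) S"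
  shows "S = Inr ` {p. \<bar>x - p\<bar> + \<bar>p - y\<bar> = \<bar>x - y\<bar>}"
proof -
  let ?D = "\<bar>x - y\<bar>"
  obtain \<gamma> where \<gamma>: "\<gamma> \<in> {0..?D} \<rightarrow> line" "\<gamma> 0 = Inr x" "\<gamma> ?D = Inr y"
    and iso: "\<And>s t. s \<in> {0..?D} \<Longrightarrow> t \<in> {0..?D} \<Longrightarrow> line_dist (\<gamma> s) (\<gamma> t) = \<bar>s - t\<bar>"
    and S: "S = \<gamma> ` {0..?D}"
    using assms unfolding geodesic_segment_def line_dist_Inr by blast
  have pt: "\<exists>p. \<gamma> t = Inr p \<and> \<bar>x - p\<bar> = t \<and> \<bar>p - y\<bar> = ?D - t" if t: "t \<in> {0..?D}" for t
  proof -
    obtain p where p: "\<gamma> t = Inr p" using \<gamma>(1) t by blast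
    have "\<bar>x - p\<bar> = \<bar>0 - t\<bar>" using iso[of 0 t] \<gamma>(2) p t by simp
    moreover have "\<bar>p - y\<bar> = \<bar>t - ?D\<bar>" using iso[of t ?D] \<gamma>(3) p t by simp
    ultimately show ?thesis using p t by auto
  qed
  show ?thesis
  proof (intro equalityI subsetI)
    fix q :: "'x + real" assume "q \<in> S"
    then obtain t where t: "t \<in> {0..?D}" "q = \<gamma> t" using S by blast
    then show "q \<in> Inr ` {p. \<bar>x - p\<bar> + \<bar>p - y\<bar> = \<bar>x - y\<bar>}" using pt[OF t(1)] by auto
  next
    fix q :: "'x + real" assume "q \<in> Inr ` {p. \<bar>x - p\<bar> + \<bar>p - y\<bar> = \<bar>x - y\<bar>}"
    then obtain p where p: "q = Inr p" "\<bar>x - p\<bar> + \<bar>p - y\<bar> = \<bar>x - y\<bar>" by auto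
    then have t: "\<bar>x - p\<bar> \<in> {0..?D}" by auto
    obtain p' where p': "\<gamma> \<bar>x - p\<bar> = Inr p'" "\<bar>x - p'\<bar> = \<bar>x - p\<bar>" "\<bar>p' - y\<bar> = ?D - \<bar>x - p\<bar>"
      using pt[OF t] by blast
    then have "p' = p" using p(2) by linarith
    then show "q \<in> S" using S p(1) p'(1) t by (metis imageI)
  qed
qed

lemma hyperbolic_space_line: "hyperbolic_space (line :: ('x + real) set) line_dist"
proof -
  have "\<exists>S. geodesic_segment line line_dist (Inr x) (Inr y :: 'x + real) S" for x y
  proof -
    let ?\<gamma> = "\<lambda>t. Inr (if x \<le> y then x + t else x - t) :: 'x + real"
    have "geodesic_segment line line_dist (Inr x) (Inr y) (?\<gamma> ` {0..line_dist (Inr x) (Inr y)})"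
      unfolding geodesic_segment_def by (rule exI[of _ ?\<gamma>]) auto
    then show ?thesis by blast
  qed
  then have "geodesic_metric_space (line :: ('x + real) set) line_dist"
    using Metric_space_line by (auto simp: geodesic_metric_space_def)
  moreover have "C \<subseteq> nbhd line line_dist 0 (A \<union> B)"
    if xyz: "x \<in> line" "y \<in> line" "z \<in> line"
      and ABC: "geodesic_segment line line_dist x y A"
      "geodesic_segment line line_dist y z B" "geodesic_segment line line_dist x z C"
    for x y z :: "'x + real" and A B C
  proof
    fix q assume q: "q \<in> C"
    obtain a b c where abc: "x = Inr a" "y = Inr b" "z = Inr c" using xyz by auto
    have S: "A = Inr ` {p. \<bar>a - p\<bar> + \<bar>p - b\<bar> = \<bar>a - b\<bar>}"
      "B = Inr ` {p. \<bar>b - p\<bar> + \<bar>p - c\<bar> = \<bar>b - c\<bar>}"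
      "C = Inr ` {p. \<bar>a - p\<bar> + \<bar>p - c\<bar> = \<bar>a - c\<bar>}"
      using geodesic_segment_line ABC unfolding abc by blast+
    obtain p where p: "q = Inr p" "\<bar>a - p\<bar> + \<bar>p - c\<bar> = \<bar>a - c\<bar>" using q S(3) by auto
    then have "\<bar>a - p\<bar> + \<bar>p - b\<bar> = \<bar>a - b\<bar> \<or> \<bar>b - p\<bar> + \<bar>p - c\<bar> = \<bar>b - c\<bar>" by linarith
    then have "q \<in> A \<union> B" using S p(1) by auto
    moreover have "line_dist q q = 0" by (simp add: line_dist_def)
    ultimately show "q \<in> nbhd line line_dist 0 (A \<union> B)" using p(1) unfolding nbhd_def by force
  qed
  ultimately show ?thesis
    unfolding hyperbolic_space_def by blast
qed

lemma subgroup_isometries: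
  "subgroup {f \<in> Bij X. \<forall>x\<in>X. \<forall>y\<in>X. d (f x) (f y) = d x y} (BijGroup X)" (is "subgroup ?K _")
proof -
  interpret group "BijGroup X" by (rule group_BijGroup)
  have car: "carrier (BijGroup X) = Bij X" by (simp add: BijGroup_def)
  have maps: "f x \<in> X" if "f \<in> Bij X" "x \<in> X" for f x
    using that by (auto simp: Bij_def bij_betw_def)
  show ?thesis
  proof (rule subgroupI)
    show "?K \<subseteq> carrier (BijGroup X)" by (auto simp: car)
    have "\<one>\<^bsub>BijGroup X\<^esub> \<in> ?K"
      using one_closed unfolding car by (auto simp: BijGroup_def)
    then show "?K \<noteq> {}" by blast
  next
    fix f assume f: "f \<in> ?K"
    let ?g = "\<lambda>x\<in>X. (inv_into X f) x"
    have g: "inv\<^bsub>BijGroup X\<^esub> f = ?g" using f by (simp add: inv_BijGroup)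
    have gB: "?g \<in> Bij X" using f inv_closed[of f] unfolding car g by simp
    have "d (?g x) (?g y) = d x y" if "x \<in> X" "y \<in> X" for x y
    proof -
      have "f (?g x) = x" "f (?g y) = y"
        using f that by (auto simp: Bij_def bij_betw_def f_inv_into_f)
      then show ?thesis using f maps[OF gB] that by (metis (mono_tags, lifting) mem_Collect_eq)
    qed
    then show "inv\<^bsub>BijGroup X\<^esub> f \<in> ?K" using g gB by simp
  next
    fix f g assume fg: "f \<in> ?K" "g \<in> ?K"
    then have "f \<otimes>\<^bsub>BijGroup X\<^esub> g \<in> Bij X" using m_closed unfolding car by blast
    then show "f \<otimes>\<^bsub>BijGroup X\<^esub> g \<in> ?K"
      using fg maps by (auto simp: BijGroup_def compose_def)
  qed
qed

text \<open>The restriction to \<open>line\<close> is there because the elements of \<^const>\<open>BijGroup\<close> are extensional.\<close>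

definition line_map :: "(real \<Rightarrow> real) \<Rightarrow> 'x + real \<Rightarrow> 'x + real" where
  "line_map f = (\<lambda>p\<in>line. Inr (f (projr p)))"

lemma line_map_Inr [simp]: "line_map f (Inr a) = Inr (f a)"
  by (simp add: line_map_def)

lemma line_map_Bij: "bij f \<Longrightarrow> line_map f \<in> Bij line"
  by (auto simp: Bij_def line_map_def bij_betw_def inj_on_def image_image)

lemma line_map_compose:
  assumes "bij f" "bij g"
  shows "line_map f \<otimes>\<^bsub>BijGroup line\<^esub> line_map g = line_map (f \<circ> g)"
proof -
  have "compose line (line_map f) (line_map g) = line_map (f \<circ> g)"
    by (rule extensionalityI[of _ line]) (auto simp: compose_def line_map_def)
  then show ?thesis using assms by (simp add: BijGroup_def line_map_Bij)
qed

lemma line_map_id: "line_map id = \<one>\<^bsub>BijGroup line\<^esub>"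
  by (auto simp: BijGroup_def line_map_def restrict_def fun_eq_iff)

lemma translation_int_pow:
  "line_map (\<lambda>x. x - 1) [^]\<^bsub>BijGroup (line :: ('x + real) set)\<^esub> (n :: int) =
    line_map (\<lambda>x. x - of_int n)"
proof -
  let ?B = "BijGroup (line :: ('x + real) set)"
  let ?T = "\<lambda>c. line_map (\<lambda>x. x - c) :: 'x + real \<Rightarrow> 'x + real"
  interpret B: group ?B by (rule group_BijGroup)
  have bij: "bij (\<lambda>x. x - c)" for c :: real
    by (rule bij_betw_byWitness[where f' = "\<lambda>x. x + c"]) auto
  have car: "?T c \<in> carrier ?B" for c
    using line_map_Bij[OF bij] by (simp add: BijGroup_def)
  have add: "?T a \<otimes>\<^bsub>?B\<^esub> ?T b = ?T (a + b)" for a b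
    by (simp add: line_map_compose bij o_def algebra_simps)
  have zero: "line_map (\<lambda>x. x) = \<one>\<^bsub>?B\<^esub>"
    by (simp add: line_map_id[unfolded id_def])
  have nat: "?T 1 [^]\<^bsub>?B\<^esub> k = ?T (real k)" for k :: nat
    by (induction k) (simp_all add: zero add add.commute)
  show ?thesis
  proof (cases n rule: int_cases2)
    case (nonneg k)
    then show ?thesis by (simp add: int_pow_int nat)
  next
    case (nonpos k)
    have "inv\<^bsub>?B\<^esub> (?T (real k)) = ?T (- real k)"
      using add[of "- real k" "real k"] car zero
      by (intro B.inv_equality) (simp_all only: add.left_inverse diff_zero)
    then show ?thesis
      using nonpos car by (simp add: B.int_pow_neg int_pow_int nat)
  qed
qed

section \<open>Graphs that are not complete\<close>

definition reflection :: "'v \<Rightarrow> 'v \<Rightarrow> 'v \<Rightarrow> real \<Rightarrow> real" where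
  "reflection s t v x = (if v = s then - x else if v = t then 1 - x else x)"

lemma reflection_involution: "reflection s t v \<circ> reflection s t v = id"
  by (auto simp: reflection_def fun_eq_iff)

lemma reflection_bij: "bij (reflection s t v)"
  using reflection_involution by (metis o_bij)

text \<open>An edge \<open>{a, b}\<close> differs from \<open>{s, t}\<close>, so one of \<open>a\<close>, \<open>b\<close> is sent to the identity and \<open>(a b)\<^sup>2\<close> to
  the square of a single reflection, or to the identity.\<close>

lemma right_angled_dihedral_action:
  assumes graph: "coxeter_graph V E m" "right_angled E m" and st: "s \<noteq> t" "{s, t} \<notin> E"
  obtains \<phi> :: "'v word set \<Rightarrow> 'x + real \<Rightarrow> 'x + real" where
    "isometric_action (coxeter_group V E m) line line_dist \<phi>"
    "\<And>v. v \<in> V \<Longrightarrow> \<phi> (word_cong V (coxeter_relators V E m) `` {[(v, True)]}) =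
      line_map (reflection s t v)"
proof -
  let ?R = "coxeter_relators V E m"
  let ?B = "BijGroup (line :: ('x + real) set)"
  let ?K = "{f \<in> Bij (line :: ('x + real) set). \<forall>p\<in>line. \<forall>q\<in>line. line_dist (f p) (f q) = line_dist p q}"
  let ?r = "reflection s t"
  define f where "f v = (line_map (?r v) :: 'x + real \<Rightarrow> 'x + real)" for v
  interpret B: group ?B by (rule group_BijGroup)
  have fK: "f \<in> V \<rightarrow> ?K"
    unfolding f_def by (auto simp: line_map_Bij reflection_bij) (auto simp: reflection_def)
  have fB: "f v \<in> carrier ?B" for v
    by (simp add: f_def BijGroup_def line_map_Bij reflection_bij)
  have mult: "f a \<otimes>\<^bsub>?B\<^esub> f b = line_map (?r a \<circ> ?r b)" for a b
    by (simp add: f_def line_map_compose reflection_bij)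
  have "word_value ?B f r = \<one>\<^bsub>?B\<^esub>" if "r \<in> ?R" for r
    using that unfolding coxeter_relators_def
  proof (elim UnE CollectE exE conjE)
    fix a assume "r = [(a, True), (a, True)]"
    then show ?thesis
      by (simp add: fB mult reflection_involution line_map_id)
  next
    fix a b assume r: "r = concat (replicate (m {a, b}) [(a, True), (b, True)])" and e: "{a, b} \<in> E"
    have "m {a, b} = 2" using graph(2) e by (simp add: right_angled_def)
    then have r2: "r = [(a, True), (b, True), (a, True), (b, True)]"
      using r by (simp add: numeral_2_eq_2)
    have "{a, b} \<in> {{s, t} |s t. s \<in> V \<and> t \<in> V \<and> s \<noteq> t}"
      using graph(1) e unfolding coxeter_graph_def by blast
    then have "a \<noteq> b" by (auto simp: doubleton_eq_iff)
    moreover have "{a, b} \<noteq> {s, t}" using e st(2) by metis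
    ultimately have inv: "(?r a \<circ> ?r b) \<circ> (?r a \<circ> ?r b) = id"
      by (auto simp: reflection_def fun_eq_iff)
    have "word_value ?B f r = (f a \<otimes>\<^bsub>?B\<^esub> f b) \<otimes>\<^bsub>?B\<^esub> (f a \<otimes>\<^bsub>?B\<^esub> f b)"
      using fB by (simp add: r2 B.m_assoc)
    also have "\<dots> = line_map id"
      unfolding mult inv[symmetric] by (intro line_map_compose bij_comp reflection_bij)
    finally show ?thesis by (simp add: line_map_id)
  qed
  then obtain \<phi> where hom: "\<phi> \<in> hom (presented_group V ?R) ?B"
    and \<phi>: "\<And>w. w \<in> words V \<Longrightarrow> \<phi> (word_cong V ?R `` {w}) = word_value ?B f w"
    using presented_group_hom[of ?B f V ?R] fB B.group_axioms by blast
  have "group_action (presented_group V ?R) line \<phi>"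
    using hom group_presented_group group_BijGroup
    by (auto simp: group_action_def group_hom_def group_hom_axioms_def)
  moreover have "\<phi> g \<in> ?K" if "g \<in> carrier (presented_group V ?R)" for g
    using that word_value_in_subgroup[OF B.group_axioms subgroup_isometries fK]
    unfolding presented_group_carrier by (elim imageE) (simp only: \<phi>)
  ultimately have "isometric_action (coxeter_group V E m) line line_dist \<phi>"
    unfolding isometric_action_def coxeter_group_def by blast
  moreover have "\<phi> (word_cong V ?R `` {[(v, True)]}) = line_map (?r v)" if "v \<in> V" for v
    using \<phi>[of "[(v, True)]"] that fB by (simp add: f_def)
  ultimately show ?thesis using that by blast
qed

lemma not_complete_not_NL:
  assumes graph: "coxeter_graph V E m" "right_angled E m" and "\<not> complete_graph V E"
  shows "\<not> property_NL TYPE('x + real) (coxeter_group V E m)"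
proof -
  obtain s t where st: "s \<in> V" "t \<in> V" "s \<noteq> t" "{s, t} \<notin> E"
    using assms(3) by (auto simp: complete_graph_def)
  let ?G = "coxeter_group V E m"
  let ?B = "BijGroup (line :: ('x + real) set)"
  let ?\<gamma> = "\<lambda>v. word_cong V (coxeter_relators V E m) `` {[(v, True)]}"
  obtain \<phi> :: "_ \<Rightarrow> 'x + real \<Rightarrow> 'x + real" where
    act: "isometric_action ?G line line_dist \<phi>"
    and \<phi>: "\<And>v. v \<in> V \<Longrightarrow> \<phi> (?\<gamma> v) = line_map (reflection s t v)"
    using right_angled_dihedral_action[OF graph st(3,4)] by metis
  interpret group_hom ?G ?B \<phi>
    using act by (simp add: isometric_action_def group_action_def)
  have gen: "?\<gamma> v \<in> carrier ?G" if "v \<in> V" for v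
    using that by (auto simp: coxeter_group_def presented_group_carrier)
  let ?g = "?\<gamma> s \<otimes>\<^bsub>?G\<^esub> ?\<gamma> t"
  have g: "?g \<in> carrier ?G" using gen st by simp
  have "\<phi> ?g = line_map (reflection s t s \<circ> reflection s t t)"
    using gen st by (simp add: \<phi> line_map_compose reflection_bij)
  also have "reflection s t s \<circ> reflection s t t = (\<lambda>x. x - 1)"
    using st(3) by (auto simp: reflection_def fun_eq_iff)
  finally have "\<phi> (?g [^]\<^bsub>?G\<^esub> n) = line_map (\<lambda>x. x - of_int n)" for n :: int
    using g by (simp add: hom_int_pow translation_int_pow)
  then have "loxodromic ?G line line_dist \<phi> ?g"
    unfolding loxodromic_def quasi_isometric_embedding_def
    by (intro bexI[of _ "Inr 0"] conjI exI[of _ "1 :: real"]) auto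
  then show ?thesis
    using act hyperbolic_space_line g unfolding property_NL_def by blast
qed

theorem theorem2:
  fixes V :: "'v set" and E :: "'v set set" and m :: "'v set \<Rightarrow> nat"
  assumes "coxeter_graph V E m" and "right_angled E m"
  shows "property_NL TYPE('x + real) (coxeter_group V E m) \<longleftrightarrow> complete_graph V E"
proof
  assume "property_NL TYPE('x + real) (coxeter_group V E m)"
  then show "complete_graph V E"
    using not_complete_not_NL[OF assms] by blast
next
  let ?G = "coxeter_group V E m"
  assume complete: "complete_graph V E"
  interpret G: group ?G unfolding coxeter_group_def by (rule group_presented_group)
  have "g [^]\<^bsub>?G\<^esub> (2::nat) = \<one>\<^bsub>?G\<^esub>" if "g \<in> carrier ?G" for g
    using complete_right_angled_square[OF assms(2) complete that] that
    by (simp add: numeral_2_eq_2)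
  then show "property_NL TYPE('x + real) ?G"
    unfolding property_NL_def hyperbolic_space_def geodesic_metric_space_def
    using finite_order_not_loxodromic[where G = ?G and n = 2] by (metis zero_less_numeral)
qed

end
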